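(* For every $m\ge 2$, the greedy procedure described below returns $G=R_m$.
   Context: Let $m\ge2$ and start with nested sets $S_0\subset S_1\subset\cdots\subset S_m$ with $\#S_i=i$ (e.g. $S_i=\{1,\ldots,i\}$). For $1\le i\le m-1$ let $S_i^*=S_{i-1}\cup(S_{i+1}\setminus S_i)$ denote the alteration of $S_i$ with respect to the current chain. Greedy procedure: set $G=[\ ]$, $\mathcal{S}=\{S_1,\ldots,S_m\}$, $J=\{1,\ldots,m-1\}$. While $J\neq\emptyset$: let $j=\max J$; append $j$ to $G$; replace $S_j$ by $S_j^*$; add the new $S_j$ to $\mathcal{S}$; set $J=\{i\in\{1,\ldots,m-1\}: S_i^*\notin\mathcal{S}\}$ (computed with the current chain). Return $G$. The sequences $R_m$ are defined by $R_2=[1]$ and $R_m=(R_{m-1}+1)\cup[1,2,\ldots,m-1]\cup R_{m-1}$ for $m\ge3$, where $\cup$ is concatenation and $R_{m-1}+1$ adds $1$ to each entry. *)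

theory Defs
  imports Main "HOL-Library.While_Combinator"
begin

definition alteration :: "(nat \<Rightarrow> 'a set) \<Rightarrow> nat \<Rightarrow> 'a set" where
  "alteration S i = S (i - 1) \<union> (S (i + 1) - S i)"

record 'a greedy_state =
  moves :: "nat list"
  chain :: "nat \<Rightarrow> 'a set"
  seen :: "'a set set"
  candidates :: "nat set"

definition greedy_init :: "nat \<Rightarrow> (nat \<Rightarrow> 'a set) \<Rightarrow> 'a greedy_state" where
  "greedy_init m S =
     \<lparr>moves = [], chain = S, seen = S ` {1..m}, candidates = {1..m - 1}\<rparr>"

definition greedy_step :: "nat \<Rightarrow> 'a greedy_state \<Rightarrow> 'a greedy_state" where
  "greedy_step m s =
     (let j = Max (candidates s);
          T = (chain s)(j := alteration (chain s) j);
          seen' = insert (T j) (seen s)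
      in \<lparr>moves = moves s @ [j], chain = T, seen = seen',
          candidates = {i \<in> {1..m - 1}. alteration T i \<notin> seen'}\<rparr>)"

text \<open>The result is \<open>None\<close> exactly when the loop does not terminate.\<close>

definition greedy :: "nat \<Rightarrow> (nat \<Rightarrow> 'a set) \<Rightarrow> nat list option" where
  "greedy m S =
     map_option moves
       (while_option (\<lambda>s. candidates s \<noteq> {}) (greedy_step m) (greedy_init m S))"

text \<open>Only the values for \<open>m \<ge> 2\<close> are meaningful; the value for \<open>m < 2\<close> is a dummy.\<close>

fun R :: "nat \<Rightarrow> nat list" where
  "R m = (if m < 2 then []
          else if m = 2 then [1]
          else map (\<lambda>x. x + 1) (R (m - 1)) @ [1..<m] @ R (m - 1))"

declare R.simps [simp del]

end

theory Submission
  imports Defs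
begin

text \<open>
  Write the chain as a word, the set \<open>S i\<close> being the set of the first \<open>i\<close> letters; altering \<open>S i\<close>
  swaps the letters number \<open>i\<close> and \<open>i + 1\<close>. By induction, the greedy procedure acts on a factor
  \<open>xs\<close> of the word \<open>pre @ xs @ suf\<close> by the moves of \<open>R (length xs)\<close>, shifted by \<open>length pre\<close>, and
  thereby visits every set \<open>pre \<union> A\<close> with \<open>{} \<noteq> A \<subseteq> xs\<close>, provided that all sets containing \<open>pre\<close>
  and meeting \<open>suf\<close> were seen before. For \<open>xs = a # b\<close> it first treats \<open>b\<close> with \<open>a\<close> appended to
  \<open>pre\<close>, after which all sets containing \<open>a\<close> are exhausted; this forces \<open>a\<close> to travel to the
  right end of the factor, and then the remaining letters are treated with \<open>a\<close> prepended to \<open>suf\<close>.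
\<close>

section \<open>Greedy runs on words\<close>

text \<open>The two side conditions of \<open>step\<close> make \<open>Suc (length u)\<close> the
  largest candidate: its alteration is new, and every swap further right gives a set in
  \<open>V\<close>. Nothing requires the final word to be stuck, so partial runs can be
  concatenated.\<close>

inductive greedy_path ::
    "'a list \<Rightarrow> 'a set set \<Rightarrow> nat list \<Rightarrow> 'a list \<Rightarrow> 'a set set \<Rightarrow> bool" where
  nil: "greedy_path w V [] w V"
| step: "\<lbrakk>insert y (set u) \<notin> V;
    \<And>u' x' y' v'. u @ x # y # v = u' @ x' # y' # v' \<Longrightarrow> length u < length u'
       \<Longrightarrow> insert y' (set u') \<in> V;
    greedy_path (u @ y # x # v) (insert (insert y (set u)) V) js w' V'\<rbrakk>
   \<Longrightarrow> greedy_path (u @ x # y # v) V (Suc (length u) # js) w' V'"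

lemma greedy_path_append:
  assumes "greedy_path w V js w' V'" "greedy_path w' V' ks w'' V''"
  shows "greedy_path w V (js @ ks) w'' V''"
  using assms by induction (auto intro: greedy_path.step)

lemma image_atLeastAtMost_Suc:
  "f ` {1..Suc n} = insert (f (Suc 0)) ((\<lambda>i. f (Suc i)) ` {1..n})"
proof -
  have "{1..Suc n} = insert 1 (Suc ` {1..n})" by auto
  then show ?thesis by (simp only: image_insert image_image One_nat_def)
qed

text \<open>A swap to the right of the one moving \<open>a\<close> yields a set containing
  \<open>u\<close> and \<open>a\<close>, which is already seen; swapping \<open>a\<close> with its
  right neighbour yields a new prefix. So the largest candidate always follows \<open>a\<close>, and
  the indices increase one by one.\<close>

lemma greedy_path_sweep:
  assumes "distinct (u @ a # c @ suf)"
    and "\<And>X. a \<in> X \<Longrightarrow> set u \<subseteq> X \<Longrightarrow> X \<subseteq> set (u @ a # c @ suf) \<Longrightarrow> X \<in> V"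
    and "\<And>k. k \<in> {1..length c} \<Longrightarrow> set u \<union> set (take k c) \<notin> V"
  shows "greedy_path (u @ a # c @ suf) V [Suc (length u)..<Suc (length u + length c)]
           (u @ c @ a # suf) (V \<union> (\<lambda>k. set u \<union> set (take k c)) ` {1..length c})"
  using assms
proof (induction c arbitrary: u V)
  case Nil
  then show ?case by (simp add: greedy_path.nil)
next
  case (Cons y c)
  let ?V = "insert (insert y (set u)) V"
  have img: "(\<lambda>k. set u \<union> set (take k (y # c))) ` {1..length (y # c)}
      = insert (insert y (set u)) ((\<lambda>k. set (u @ [y]) \<union> set (take k c)) ` {1..length c})"
    by (simp add: image_atLeastAtMost_Suc del: One_nat_def image_Suc_atLeastAtMost)
  have path: "greedy_path ((u @ [y]) @ a # c @ suf) ?V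
      [Suc (length (u @ [y]))..<Suc (length (u @ [y]) + length c)]
      ((u @ [y]) @ c @ a # suf)
      (?V \<union> (\<lambda>k. set (u @ [y]) \<union> set (take k c)) ` {1..length c})"
  proof (rule Cons.IH)
    show "distinct ((u @ [y]) @ a # c @ suf)" using Cons.prems(1) by auto
    show "X \<in> ?V" if "a \<in> X" "set (u @ [y]) \<subseteq> X" "X \<subseteq> set ((u @ [y]) @ a # c @ suf)" for X
      using Cons.prems(2)[of X] that by auto
    \<comment> \<open>The set just inserted could be mistaken for a later target; the first letter
      \<open>z\<close> of \<open>c\<close> lies in each later target but not in
      \<open>insert y (set u)\<close>.\<close>
    show "set (u @ [y]) \<union> set (take k c) \<notin> ?V" if k: "k \<in> {1..length c}" for k
    proof -
      obtain z c' where c: "c = z # c'" using k by (cases c) auto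
      then have "z \<in> set (take k c)" using k by (cases k) auto
      moreover have "z \<notin> insert y (set u)" using Cons.prems(1) c by auto
      ultimately have "set (u @ [y]) \<union> set (take k c) \<noteq> insert y (set u)" by blast
      with Cons.prems(3)[of "Suc k"] k show ?thesis by auto
    qed
  qed
  have "greedy_path (u @ a # y # (c @ suf)) V
      (Suc (length u) # [Suc (length (u @ [y]))..<Suc (length (u @ [y]) + length c)])
      ((u @ [y]) @ c @ a # suf)
      (?V \<union> (\<lambda>k. set (u @ [y]) \<union> set (take k c)) ` {1..length c})"
  proof (rule greedy_path.step)
    show "insert y (set u) \<notin> V" using Cons.prems(3)[of 1] by simp
    show "insert y' (set u') \<in> V"
      if eq: "u @ a # y # c @ suf = u' @ x' # y' # v'" and len: "length u < length u'"
      for u' x' y' v'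
    proof (rule Cons.prems(2))
      have "take (Suc (length u)) (u @ a # y # c @ suf) = u @ [a]" by simp
      moreover have "take (Suc (length u)) (u' @ x' # y' # v') = take (Suc (length u)) u'"
        using len by simp
      ultimately have "set (u @ [a]) \<subseteq> set u'" using eq by (metis set_take_subset)
      then show "a \<in> insert y' (set u')" "set u \<subseteq> insert y' (set u')" by auto
      have "set (u @ a # y # c @ suf) = set (u' @ x' # y' # v')" using eq by simp
      then show "insert y' (set u') \<subseteq> set (u @ a # (y # c) @ suf)" by auto
    qed
    show "greedy_path (u @ y # a # c @ suf) ?V
      [Suc (length (u @ [y]))..<Suc (length (u @ [y]) + length c)]
      ((u @ [y]) @ c @ a # suf)
      (?V \<union> (\<lambda>k. set (u @ [y]) \<union> set (take k c)) ` {1..length c})"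
      using path by simp
  qed
  moreover have "[Suc (length u)..<Suc (length u + length (y # c))]
     = Suc (length u) # [Suc (length (u @ [y]))..<Suc (length (u @ [y]) + length c)]"
    by (subst upt_conv_Cons) simp_all
  ultimately show ?case unfolding img by simp
qed

section \<open>The moves of \<open>R\<close> on a factor of the word\<close>

text \<open>The dummy value \<open>R 1 = []\<close> makes the recursion valid at
  \<open>n = 1\<close> as well, so the induction below can start with a factor of one
  letter.\<close>

lemma R_Suc: "n \<ge> 1 \<Longrightarrow> R (Suc n) = map Suc (R n) @ [1..<Suc n] @ R n"
  by (cases "n = 1") (simp_all add: R.simps[of "Suc n"] R.simps[of "Suc 0"] R.simps[of "Suc (Suc 0)"])

text \<open>The third assumption says that among the sets to be visited exactly the current prefixes
  are seen; the fourth blocks all swaps involving \<open>suf\<close>, including the one across its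
  left border. The final order \<open>ys\<close> is left open: its letters and length suffice to
  continue the induction.\<close>

lemma greedy_path_factor:
  assumes "length xs = Suc n" "distinct (pre @ xs @ suf)"
    and "\<And>A. A \<subseteq> set xs \<Longrightarrow> A \<noteq> {} \<Longrightarrow>
           set pre \<union> A \<in> V \<longleftrightarrow> A \<in> (\<lambda>i. set (take i xs)) ` {1..Suc n}"
    and "\<And>X. set pre \<subseteq> X \<Longrightarrow> X \<inter> set suf \<noteq> {} \<Longrightarrow> X \<subseteq> set (pre @ xs @ suf) \<Longrightarrow> X \<in> V"
  shows "\<exists>ys. set ys = set xs \<and> length ys = Suc n \<and>
    greedy_path (pre @ xs @ suf) V (map ((+) (length pre)) (R (Suc n))) (pre @ ys @ suf)
      (V \<union> {set pre \<union> A |A. A \<subseteq> set xs \<and> A \<noteq> {}})"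
  using assms
proof (induction n arbitrary: pre xs suf V)
  case 0
  then obtain a where a: "xs = [a]" by (auto simp: length_Suc_conv)
  have "set pre \<union> {a} \<in> V" using "0.prems"(3)[of "{a}"] a by simp
  moreover have "{set pre \<union> A |A. A \<subseteq> set xs \<and> A \<noteq> {}} = {set pre \<union> {a}}"
    using a by (simp add: subset_singleton_iff conj_disj_distribR)
  ultimately have "V \<union> {set pre \<union> A |A. A \<subseteq> set xs \<and> A \<noteq> {}} = V" by auto
  moreover have "R (Suc 0) = []" by (subst R.simps) simp
  ultimately show ?case
    using a greedy_path.nil[of "pre @ xs @ suf" V] by (intro exI[of _ xs]) simp
next
  case (Suc n)
  obtain a b where xs: "xs = a # b" and b: "length b = Suc n"
    using Suc.prems(1) by (cases xs) auto
  note seen = Suc.prems(3) and suf = Suc.prems(4)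
  have dist: "distinct (pre @ a # b @ suf)" using Suc.prems(2) xs by simp
  have prefixes: "(\<lambda>i. set (take i xs)) ` {1..Suc (Suc n)}
      = insert {a} ((\<lambda>i. insert a (set (take i b))) ` {1..Suc n})"
    by (simp add: image_atLeastAtMost_Suc xs del: One_nat_def image_Suc_atLeastAtMost)
  have pre_a: "insert a (set pre) \<in> V"
    using seen[of "{a}"] xs unfolding prefixes by simp
  \<comment> \<open>Each seen prefix of \<open>xs\<close> contains the first letter
    \<open>a\<close>, whereas \<open>A\<close> does not.\<close>
  have unseen: "set pre \<union> A \<notin> V" if "A \<subseteq> set b" "A \<noteq> {}" for A
  proof -
    have "A \<subseteq> set xs" "a \<notin> A" using that dist xs by auto
    then show ?thesis using seen[of A] that unfolding prefixes by auto
  qed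

  let ?V1 = "V \<union> {set (pre @ [a]) \<union> A |A. A \<subseteq> set b \<and> A \<noteq> {}}"
  \<comment> \<open>First phase: \<open>a\<close> joins the fixed left part, whose extra letter
    accounts for the shift by one in the first block of \<open>R\<close>.\<close>
  have "\<exists>ys. set ys = set b \<and> length ys = Suc n \<and>
    greedy_path ((pre @ [a]) @ b @ suf) V (map ((+) (length (pre @ [a]))) (R (Suc n)))
      ((pre @ [a]) @ ys @ suf) ?V1"
  proof (rule Suc.IH)
    show "length b = Suc n" "distinct ((pre @ [a]) @ b @ suf)" using b dist by auto
    show "set (pre @ [a]) \<union> A \<in> V \<longleftrightarrow> A \<in> (\<lambda>i. set (take i b)) ` {1..Suc n}"
      if A: "A \<subseteq> set b" "A \<noteq> {}" for A
    proof -
      have aA: "a \<notin> A" and ab: "\<And>i. a \<notin> set (take i b)"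
        using A dist by (auto dest: in_set_takeD)
      have "set (pre @ [a]) \<union> A = set pre \<union> insert a A" by auto
      moreover have "set pre \<union> insert a A \<in> V \<longleftrightarrow>
          insert a A \<in> insert {a} ((\<lambda>i. insert a (set (take i b))) ` {1..Suc n})"
        using seen[of "insert a A"] A xs unfolding prefixes by auto
      moreover have "insert a A \<noteq> {a}" using A aA by auto
      moreover have "insert a A = insert a (set (take i b)) \<longleftrightarrow> A = set (take i b)" for i
        using aA ab[of i] by (metis insert_ident)
      ultimately show ?thesis by (simp add: image_iff)
    qed
    show "X \<in> V" if "set (pre @ [a]) \<subseteq> X" "X \<inter> set suf \<noteq> {}"
        "X \<subseteq> set ((pre @ [a]) @ b @ suf)" for X
      using suf[of X] that xs by auto
  qed
  then obtain c where c: "set c = set b" "length c = Suc n"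
    and path1: "greedy_path (pre @ a # b @ suf) V (map ((+) (Suc (length pre))) (R (Suc n)))
      (pre @ a # c @ suf) ?V1"
    by auto
  have dist_c: "distinct (pre @ a # c @ suf)"
  proof -
    have "distinct c" using c b dist by (metis card_distinct distinct_card distinct_append distinct.simps(2))
    then show ?thesis using dist c by auto
  qed
  \<comment> \<open>Such a set meets \<open>suf\<close>, or is the prefix \<open>pre @ [a]\<close>
    seen from the start, or was visited in the first phase. This is what forces the sweep.\<close>
  have seen_a: "X \<in> ?V1"
    if "a \<in> X" "set pre \<subseteq> X" "X \<subseteq> set (pre @ a # c @ suf)" for X
  proof (cases "X \<inter> set suf = {}")
    case True
    let ?A = "X - insert a (set pre)"
    have X: "X = set (pre @ [a]) \<union> ?A" and A: "?A \<subseteq> set b" using that True c by auto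
    show ?thesis
    proof (cases "?A = {}")
      case True
      then have "X = insert a (set pre)" using X by auto
      then show ?thesis using pre_a by simp
    next
      case False
      then show ?thesis using X A by blast
    qed
  next
    case False
    then show ?thesis using suf[of X] that xs c by auto
  qed
  have unseen1: "set pre \<union> A \<notin> ?V1" if "A \<subseteq> set b" "A \<noteq> {}" for A
  proof -
    have "a \<notin> set pre \<union> A" using that dist by auto
    then show ?thesis using unseen[OF that] by auto
  qed
  let ?V2 = "?V1 \<union> (\<lambda>k. set pre \<union> set (take k c)) ` {1..length c}"
  have path2: "greedy_path (pre @ a # c @ suf) ?V1
      [Suc (length pre)..<Suc (length pre + length c)] (pre @ c @ a # suf) ?V2"
  proof (rule greedy_path_sweep[OF dist_c seen_a])
    show "set pre \<union> set (take k c) \<notin> ?V1" if "k \<in> {1..length c}" for k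
    proof (rule unseen1)
      show "set (take k c) \<subseteq> set b" using c by (metis set_take_subset)
      show "set (take k c) \<noteq> {}" using that by auto
    qed
  qed

  \<comment> \<open>Third phase: the sweep has recorded precisely the prefixes of \<open>c\<close>,
    so the induction hypothesis applies again, now with \<open>a\<close> in the blocked right
    part.\<close>
  have "\<exists>ys. set ys = set c \<and> length ys = Suc n \<and>
    greedy_path (pre @ c @ (a # suf)) ?V2 (map ((+) (length pre)) (R (Suc n)))
      (pre @ ys @ (a # suf)) (?V2 \<union> {set pre \<union> A |A. A \<subseteq> set c \<and> A \<noteq> {}})"
  proof (rule Suc.IH)
    show "length c = Suc n" "distinct (pre @ c @ a # suf)" using c dist_c by auto
    show "set pre \<union> A \<in> ?V2 \<longleftrightarrow> A \<in> (\<lambda>i. set (take i c)) ` {1..Suc n}"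
      if A: "A \<subseteq> set c" "A \<noteq> {}" for A
    proof -
      have "set pre \<union> A = set pre \<union> set (take k c) \<longleftrightarrow> A = set (take k c)" for k
      proof -
        have "set pre \<inter> A = {}" "set pre \<inter> set (take k c) = {}"
          using A dist_c by (auto dest: in_set_takeD)
        then show ?thesis by blast
      qed
      moreover have "set pre \<union> A \<notin> ?V1" using unseen1[of A] A c by simp
      ultimately show ?thesis by (simp only: Un_iff[of _ ?V1] c(2) image_iff simp_thms)
    qed
    show "X \<in> ?V2" if "set pre \<subseteq> X" "X \<inter> set (a # suf) \<noteq> {}"
        "X \<subseteq> set (pre @ c @ a # suf)" for X
    proof (cases "a \<in> X")
      case True
      then show ?thesis using seen_a[of X] that by auto
    next
      case False
      then show ?thesis using suf[of X] that xs c by auto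
    qed
  qed
  then obtain d where d: "set d = set c" "length d = Suc n"
    and path3: "greedy_path (pre @ c @ a # suf) ?V2 (map ((+) (length pre)) (R (Suc n)))
      (pre @ d @ a # suf) (?V2 \<union> {set pre \<union> A |A. A \<subseteq> set c \<and> A \<noteq> {}})"
    by blast
  have V: "?V2 \<union> {set pre \<union> A |A. A \<subseteq> set c \<and> A \<noteq> {}}
      = V \<union> {set pre \<union> A |A. A \<subseteq> set xs \<and> A \<noteq> {}}" (is "?L = ?R")
  proof
    have mem: "set pre \<union> A \<in> ?R" if "A \<subseteq> set xs" "A \<noteq> {}" for A
      using that by blast
    have "set (pre @ [a]) \<union> A \<in> ?R" if "A \<subseteq> set b" for A
    proof -
      have "set pre \<union> insert a A \<in> ?R" using that xs by (intro mem) auto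
      then show ?thesis by simp
    qed
    then have "{set (pre @ [a]) \<union> A |A. A \<subseteq> set b \<and> A \<noteq> {}} \<subseteq> ?R" by blast
    moreover have "(\<lambda>k. set pre \<union> set (take k c)) ` {1..length c} \<subseteq> ?R"
    proof (rule image_subsetI)
      fix k assume k: "k \<in> {1..length c}"
      show "set pre \<union> set (take k c) \<in> ?R"
      proof (rule mem)
        show "set (take k c) \<subseteq> set xs" using xs c by (auto dest: in_set_takeD)
        show "set (take k c) \<noteq> {}" using k by auto
      qed
    qed
    moreover have "{set pre \<union> A |A. A \<subseteq> set c \<and> A \<noteq> {}} \<subseteq> ?R"
      using xs c by auto
    ultimately show "?L \<subseteq> ?R" by (intro Un_least) simp_all
    \<comment> \<open>Sets with \<open>a\<close> are covered by the first phase, sets without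
      \<open>a\<close> by the third.\<close>
    show "?R \<subseteq> ?L"
    proof -
      have "set pre \<union> A \<in> ?L" if A: "A \<subseteq> set xs" "A \<noteq> {}" for A
      proof (cases "a \<in> A")
        case True
        then have "set pre \<union> A \<in> ?V1" using A xs c by (intro seen_a) auto
        then show ?thesis by simp
      next
        case False
        then have "A \<subseteq> set c" using A xs c by auto
        then show ?thesis using A by blast
      qed
      then show ?thesis by blast
    qed
  qed
  have moves: "map ((+) (length pre)) (R (Suc (Suc n)))
     = map ((+) (Suc (length pre))) (R (Suc n)) @
       [Suc (length pre)..<Suc (length pre + length c)] @ map ((+) (length pre)) (R (Suc n))"
  proof -
    have "map ((+) (length pre)) [1..<Suc (Suc n)] = [Suc (length pre)..<Suc (length pre + Suc n)]"
      by (rule nth_equalityI) (auto simp del: upt_Suc)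
    then show ?thesis using c by (simp add: R_Suc comp_def del: upt_Suc)
  qed
  have "greedy_path (pre @ xs @ suf) V (map ((+) (length pre)) (R (Suc (Suc n))))
      (pre @ (d @ [a]) @ suf) (V \<union> {set pre \<union> A |A. A \<subseteq> set xs \<and> A \<noteq> {}})"
    using greedy_path_append[OF path1 greedy_path_append[OF path2 path3]]
    unfolding V moves by (simp add: xs)
  then show ?case using c d xs by (intro exI[of _ "d @ [a]"]) auto
qed

section \<open>Simulation of the while loop by words\<close>

text \<open>Only indices up to \<open>length w\<close> are constrained, since \<open>chain s\<close>
  is a total function. The clause on \<open>candidates\<close> has the form produced by
  \<open>greedy_step\<close>; for the initial state it needs a separate argument.\<close>

definition represents :: "'a greedy_state \<Rightarrow> 'a list \<Rightarrow> 'a set set \<Rightarrow> bool" where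
  "represents s w V \<longleftrightarrow> distinct w \<and> (\<forall>i \<le> length w. chain s i = set (take i w)) \<and>
     seen s = V \<and>
     candidates s = {i \<in> {1..length w - 1}. alteration (chain s) i \<notin> V}"

text \<open>By distinctness, the difference of the prefixes around \<open>y\<close> is
  \<open>{y}\<close>, so altering replaces \<open>x\<close> by \<open>y\<close> in the
  prefix.\<close>

lemma alteration_word:
  assumes "distinct (u @ x # y # v)"
    and "\<And>i. i \<le> length (u @ x # y # v) \<Longrightarrow> T i = set (take i (u @ x # y # v))"
  shows "alteration T (Suc (length u)) = insert y (set u)"
  using assms by (auto simp: alteration_def)

lemma split_word_at:
  assumes "1 \<le> i" "i < length w"
  shows "\<exists>u x y v. w = u @ x # y # v \<and> i = Suc (length u)"
proof (intro exI conjI)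
  show "w = take (i - 1) w @ w ! (i - 1) # w ! i # drop (Suc i) w"
    using assms id_take_nth_drop[of "i - 1" w] Cons_nth_drop_Suc[of i w] by simp
qed (use assms in simp)

lemma represents_step:
  assumes rep: "represents s (u @ x # y # v) V"
    and new: "insert y (set u) \<notin> V"
    and max: "\<And>u' x' y' v'. u @ x # y # v = u' @ x' # y' # v' \<Longrightarrow> length u < length u'
       \<Longrightarrow> insert y' (set u') \<in> V"
    and m: "m = length (u @ x # y # v)"
  shows "candidates s \<noteq> {}"
    and "moves (greedy_step m s) = moves s @ [Suc (length u)]"
    and "represents (greedy_step m s) (u @ y # x # v) (insert (insert y (set u)) V)"
proof -
  let ?w = "u @ x # y # v" and ?j = "Suc (length u)"
  from rep have dist: "distinct ?w" and ch: "\<And>i. i \<le> length ?w \<Longrightarrow> chain s i = set (take i ?w)"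
    and V: "seen s = V"
    and cand: "candidates s = {i \<in> {1..length ?w - 1}. alteration (chain s) i \<notin> V}"
    unfolding represents_def by blast+
  have alt: "alteration (chain s) ?j = insert y (set u)"
    by (rule alteration_word[OF dist ch])
  have j: "?j \<in> candidates s" using new unfolding cand alt[symmetric] by simp
  then show "candidates s \<noteq> {}" by blast
  have "i \<le> ?j" if i: "i \<in> candidates s" for i
  proof (rule ccontr)
    assume "\<not> i \<le> ?j"
    have "1 \<le> i" "i < length ?w" using i unfolding cand by auto
    then obtain u' x' y' v' where w: "?w = u' @ x' # y' # v'" "i = Suc (length u')"
      using split_word_at by metis
    then have "alteration (chain s) i = insert y' (set u')"
      using alteration_word[of u' x' y' v' "chain s"] dist ch by metis
    moreover have "insert y' (set u') \<in> V" using max w \<open>\<not> i \<le> ?j\<close> by auto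
    ultimately show False using i unfolding cand by simp
  qed
  moreover have "finite (candidates s)" unfolding cand by simp
  ultimately have Max: "Max (candidates s) = ?j" using j by (intro Max_eqI) auto
  then show "moves (greedy_step m s) = moves s @ [?j]"
    by (simp add: greedy_step_def Let_def)
  \<comment> \<open>Prefixes of any length other than \<open>?j\<close> contain both or neither of
    \<open>x\<close> and \<open>y\<close>, so the swap changes only the set at
    \<open>?j\<close>.\<close>
  have "((chain s)(?j := insert y (set u))) i = set (take i (u @ y # x # v))"
    if "i \<le> length ?w" for i
  proof -
    consider "i \<le> length u" | "i = ?j" | k where "i = Suc (Suc (length u)) + k"
      by (metis le_Suc_eq le_iff_add not_less_eq_eq)
    then show ?thesis using ch[OF that] by cases auto
  qed
  moreover have "distinct (u @ y # x # v)" using dist by auto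
  ultimately show "represents (greedy_step m s) (u @ y # x # v) (insert (insert y (set u)) V)"
    unfolding represents_def by (simp add: greedy_step_def Let_def Max alt V m)
qed

text \<open>Each move unfolds the loop once. The conclusion equates two loops instead of giving a
  result, because a path may end while candidates remain.\<close>

lemma greedy_path_while:
  assumes "greedy_path w V js w' V'" "represents s w V" "m = length w"
  shows "\<exists>s'. represents s' w' V' \<and> moves s' = moves s @ js \<and> length w' = m \<and>
     while_option (\<lambda>s. candidates s \<noteq> {}) (greedy_step m) s
      = while_option (\<lambda>s. candidates s \<noteq> {}) (greedy_step m) s'"
  using assms
proof (induction arbitrary: s)
  case (nil w V)
  then show ?case by auto
next
  case (step y u V x v js w' V')
  have rs: "candidates s \<noteq> {}" "moves (greedy_step m s) = moves s @ [Suc (length u)]"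
    "represents (greedy_step m s) (u @ y # x # v) (insert (insert y (set u)) V)"
    by (rule represents_step[OF step.prems(1) step.hyps(1) _ step.prems(2)],
        erule (1) step.hyps(2))+
  obtain s' where "represents s' w' V'" "moves s' = moves (greedy_step m s) @ js" "length w' = m"
     "while_option (\<lambda>s. candidates s \<noteq> {}) (greedy_step m) (greedy_step m s)
      = while_option (\<lambda>s. candidates s \<noteq> {}) (greedy_step m) s'"
    using step.IH[OF rs(3)] step.prems(2) by auto
  moreover have "while_option (\<lambda>s. candidates s \<noteq> {}) (greedy_step m) s
      = while_option (\<lambda>s. candidates s \<noteq> {}) (greedy_step m) (greedy_step m s)"
    using rs(1) by (subst while_option_unfold) simp
  ultimately show ?case using rs(2) by auto
qed

section \<open>The initial chain and termination\<close>

text \<open>Each cardinality exceeds the previous one by one, so every step of the chain adds a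
  single element, which becomes the next letter.\<close>

lemma chain_word:
  fixes S :: "nat \<Rightarrow> 'a set"
  assumes "\<And>i. i < m \<Longrightarrow> S i \<subset> S (i + 1)"
    and "\<And>i. i \<le> m \<Longrightarrow> finite (S i) \<and> card (S i) = i"
  shows "\<exists>w. length w = m \<and> distinct w \<and> (\<forall>i \<le> m. S i = set (take i w))"
  using assms
proof (induction m)
  case 0
  then show ?case by (metis card_0_eq distinct.simps(1) le_zero_eq list.size(3) set_empty take_eq_Nil)
next
  case (Suc m)
  then obtain w where w: "length w = m" "distinct w" "\<And>i. i \<le> m \<Longrightarrow> S i = set (take i w)"
    by (metis le_SucI less_SucI)
  have fin: "finite (S m)" "finite (S (Suc m))" and card: "card (S m) = m" "card (S (Suc m)) = Suc m"
    and sub: "S m \<subset> S (Suc m)"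
    using Suc.prems(1)[of m] Suc.prems(2)[of m] Suc.prems(2)[of "Suc m"] by auto
  have "card (S (Suc m) - S m) = 1" using fin card sub by (simp add: card_Diff_subset psubset_imp_subset)
  then obtain x where "S (Suc m) - S m = {x}" by (auto simp: card_1_singleton_iff)
  then have x: "S (Suc m) = insert x (S m)" "x \<notin> S m" using sub by auto
  have "S i = set (take i (w @ [x]))" if "i \<le> Suc m" for i
    using that w x by (cases "i = Suc m") auto
  moreover have "distinct (w @ [x])" using w x by auto
  ultimately show ?case using w by (intro exI[of _ "w @ [x]"]) auto
qed

theorem theorem3p1:
  fixes m :: nat and S :: "nat \<Rightarrow> 'a set"
  assumes "m \<ge> 2"
    and "\<And>i. i < m \<Longrightarrow> S i \<subset> S (i + 1)"
    and "\<And>i. i \<le> m \<Longrightarrow> finite (S i) \<and> card (S i) = i"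
  shows "greedy m S = Some (R m)"
proof -
  obtain w where w: "length w = m" "distinct w" and S: "\<And>i. i \<le> m \<Longrightarrow> S i = set (take i w)"
    using chain_word[OF assms(2,3)] by metis
  let ?V = "S ` {1..m}"
  have V: "?V = (\<lambda>i. set (take i w)) ` {1..m}" using S by (intro image_cong) auto
  \<comment> \<open>By cardinality the alteration could only equal \<open>S i\<close> itself, but it
    lacks the letter \<open>x\<close> of \<open>S i\<close>. Hence all indices are candidates
    initially.\<close>
  have alt_new: "alteration S i \<notin> ?V" if i: "1 \<le> i" "i < m" for i
  proof -
    obtain u x y v where uv: "w = u @ x # y # v" "i = Suc (length u)"
      using split_word_at i w by metis
    then have alt: "alteration S i = insert y (set u)"
      using alteration_word[of u x y v S] w S by auto
    have "insert y (set u) \<noteq> S k" if "k \<in> {1..m}" for k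
    proof
      assume eq: "insert y (set u) = S k"
      have "card (insert y (set u)) = i" using uv w by (simp add: distinct_card)
      then have "k = i" using eq assms(3)[of k] that by simp
      then have "x \<in> S k" using S[of k] that uv by simp
      then show False using eq uv w by auto
    qed
    then show ?thesis unfolding alt by blast
  qed
  have "alteration S i \<notin> ?V" if "i \<in> {1..m - 1}" for i
    using that assms(1) by (intro alt_new) auto
  then have "{i \<in> {1..m - 1}. alteration S i \<notin> ?V} = {1..m - 1}" by blast
  then have rep: "represents (greedy_init m S) w ?V"
    unfolding represents_def greedy_init_def using w S by simp
  obtain n where n: "m = Suc n" using assms(1) by (cases m) auto
  \<comment> \<open>With \<open>pre\<close> and \<open>suf\<close> empty the factor is the whole
    word, the shift is zero, and the condition on \<open>suf\<close> is vacuous.\<close>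
  obtain w' where "greedy_path w ?V (R m) w' (?V \<union> {A. A \<subseteq> set w \<and> A \<noteq> {}})" "set w' = set w"
    using greedy_path_factor[of w n "[]" "[]" ?V] w n V map_idI[of "R m" "(+) 0"] by auto
  moreover obtain s' where s': "represents s' w' (?V \<union> {A. A \<subseteq> set w \<and> A \<noteq> {}})"
    "moves s' = moves (greedy_init m S) @ R m" "length w' = m"
    "while_option (\<lambda>s. candidates s \<noteq> {}) (greedy_step m) (greedy_init m S)
      = while_option (\<lambda>s. candidates s \<noteq> {}) (greedy_step m) s'"
    using greedy_path_while[OF calculation(1) rep] w by blast
  \<comment> \<open>Every alteration is a nonempty subset of \<open>set w\<close>, and all of these
    have now been seen, so the loop stops.\<close>
  moreover have "candidates s' = {}"
  proof -
    have "alteration (chain s') i \<subseteq> set w \<and> alteration (chain s') i \<noteq> {}"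
      if i: "1 \<le> i" "i < m" for i
    proof -
      obtain u x y v where uv: "w' = u @ x # y # v" "i = Suc (length u)"
        using split_word_at i s'(3) by metis
      then have "alteration (chain s') i = insert y (set u)"
        using alteration_word[of u x y v "chain s'"] s'(1) unfolding represents_def by auto
      then show ?thesis using uv \<open>set w' = set w\<close> by auto
    qed
    then show ?thesis using s'(1,3) unfolding represents_def by auto
  qed
  ultimately have "while_option (\<lambda>s. candidates s \<noteq> {}) (greedy_step m) (greedy_init m S) = Some s'"
    by (simp add: while_option_unfold)
  then show ?thesis using s'(2) by (simp add: greedy_def greedy_init_def)
qed

end
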